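(* Let $m\ge 1$ and let $\mathcal S\subset\mathcal{C}\ell_m$ be the set of simplicial variables $a(u_1,\dots,u_m)$, where $(u_1,\dots,u_m)$ runs over all right-handed orthonormal bases of $\mathbb R^m$. Then functions of simplicial type are invariant under $H$. That is, for every $s\in \mathrm{Spin}(m)$ and every $a\in\mathcal S$ one has $s^{-1}as\in\mathcal S$, so that for every function $f:\mathcal S\to\mathcal{C}\ell_m$ the formula $$(H(s)f)(a)=s\,f(s^{-1}as)\,s^{-1}$$ again defines a function $H(s)f:\mathcal S\to\mathcal{C}\ell_m$ of a simplicial variable.
   Context: $\mathcal{C}\ell_m$ is the complex Clifford algebra generated by $e_1,\dots,e_m$ with relations $e_ie_j+e_je_i=-2\delta_{ij}$. The space $\mathbb R^m$ is embedded in $\mathcal{C}\ell_m$ via $(x_1,\dots,x_m)\mapsto\sum_j x_je_j$, with standard positively oriented orthonormal basis $e_1,\dots,e_m$. The group $\mathrm{Spin}(m)$ is the set of all products $s_1s_2\cdots s_{2k}$ of an even number of unit vectors $s_j\in\mathbb R^m\subset\mathcal{C}\ell_m$, with Clifford multiplication. The symbol $\wedge$ denotes the outer (exterior) product on $\mathcal{C}\ell_m$. For vectors it is $u\wedge v=\frac12(uv-vu)$, and in general $u_1\wedge\dots\wedge u_k=\frac1{k!}\sum_{\sigma}\operatorname{sgn}(\sigma)\,u_{\sigma(1)}\cdots u_{\sigma(k)}$, the sum being over all permutations of $\{1,\dots,k\}$. For an orthonormal basis $(u_1,\dots,u_m)$ of $\mathbb R^m$, the corresponding simplicial variable is $$a(u_1,\dots,u_m)=u_1+u_1\wedge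 u_2+u_1\wedge u_2\wedge u_3+\dots+u_1\wedge\dots\wedge u_m\in\mathcal{C}\ell_m .$$ A basis is right-handed if it has the same orientation as $(e_1,\dots,e_m)$. A function of simplicial type (a function of a simplicial variable) is a function defined on the set $\mathcal S$ of all $a(u_1,\dots,u_m)$ with $(u_1,\dots,u_m)$ a right-handed orthonormal basis of $\mathbb R^m$. The representation $H$ of $\mathrm{Spin}(m)$ acts on Clifford-valued functions by $(H(s)f)(a)=s f(s^{-1}as)s^{-1}$. *)

theory Defs
  imports "HOL-Analysis.Analysis"
begin

section \<open>The complex Clifford algebra\<close>

text \<open>
  The dimension \<open>m \<ge> 1\<close> is the cardinality of a finite linearly ordered index type \<open>'n\<close>, whose
  elements in increasing order play the role of \<open>1, \<dots>, m\<close>.  The algebra is realised on its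
  standard basis of blades \<open>e\<^sub>A = e\<^bsub>i1\<^esub> \<dots> e\<^bsub>ik\<^esub>\<close> with \<open>A = {i1 < \<dots> < ik}\<close>, so an element is a
  family of complex coefficients indexed by the subsets of the index type.
\<close>

datatype 'n clifford = Clifford (blade_coeff: "'n set \<Rightarrow> complex")

lemma clifford_eqI: "(\<And>A. blade_coeff x A = blade_coeff y A) \<Longrightarrow> x = y"
  by (cases x; cases y) auto

text \<open>
  \<open>e\<^sub>A e\<^sub>B = blade_sign A B \<cdot> e\<^bsub>A \<triangle> B\<^esub>\<close>: sorting the factors costs a sign for each pair
  \<open>i \<in> A\<close>, \<open>j \<in> B\<close> with \<open>j < i\<close>, and each common index contributes \<open>e\<^sub>i\<^sup>2 = -1\<close>.
\<close>

definition blade_sign :: "'n::linorder set \<Rightarrow> 'n set \<Rightarrow> complex" where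
  "blade_sign A B = (\<Prod>i\<in>A. \<Prod>j\<in>B. if j \<le> i then -1 else 1)"

lemma prod_sym_diff:
  fixes g :: "'a::finite \<Rightarrow> complex"
  assumes "\<And>i. g i * g i = 1"
  shows "prod g (sym_diff A B) = prod g A * prod g B"
proof -
  have A: "prod g A = prod g (A - B) * prod g (A \<inter> B)"
    by (subst prod.union_disjoint [symmetric]) (auto intro: prod.cong)
  have B: "prod g B = prod g (B - A) * prod g (A \<inter> B)"
    by (subst prod.union_disjoint [symmetric]) (auto intro: prod.cong)
  have D: "prod g (sym_diff A B) = prod g (A - B) * prod g (B - A)"
    by (subst prod.union_disjoint) auto
  have "prod g (A \<inter> B) * prod g (A \<inter> B) = 1"
    by (simp add: prod.distrib [symmetric] assms)
  then show ?thesis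
    unfolding A B D by (simp add: algebra_simps)
qed

lemma blade_sign_sym_diff_left:
  fixes A B C :: "'n::{finite,linorder} set"
  shows "blade_sign (sym_diff A B) C = blade_sign A C * blade_sign B C"
  unfolding blade_sign_def
  by (rule prod_sym_diff) (auto simp: prod.distrib [symmetric] intro!: prod.neutral)

lemma blade_sign_sym_diff_right:
  fixes A B C :: "'n::{finite,linorder} set"
  shows "blade_sign A (sym_diff B C) = blade_sign A B * blade_sign A C"
  unfolding blade_sign_def prod.distrib [symmetric]
  by (rule prod.cong [OF refl], rule prod_sym_diff) auto

lemma blade_sign_empty [simp]: "blade_sign {} B = 1" "blade_sign A {} = 1"
  by (simp_all add: blade_sign_def)

instantiation clifford :: ("{finite,linorder}") real_algebra_1
begin

definition zero_clifford :: "'a clifford" where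
  "0 = Clifford (\<lambda>A. 0)"

definition one_clifford :: "'a clifford" where
  "1 = Clifford (\<lambda>A. if A = {} then 1 else 0)"

definition plus_clifford :: "'a clifford \<Rightarrow> 'a clifford \<Rightarrow> 'a clifford" where
  "x + y = Clifford (\<lambda>A. blade_coeff x A + blade_coeff y A)"

definition uminus_clifford :: "'a clifford \<Rightarrow> 'a clifford" where
  "- x = Clifford (\<lambda>A. - blade_coeff x A)"

definition minus_clifford :: "'a clifford \<Rightarrow> 'a clifford \<Rightarrow> 'a clifford" where
  "x - y = Clifford (\<lambda>A. blade_coeff x A - blade_coeff y A)"

definition scaleR_clifford :: "real \<Rightarrow> 'a clifford \<Rightarrow> 'a clifford" where
  "r *\<^sub>R x = Clifford (\<lambda>A. r *\<^sub>R blade_coeff x A)"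

text \<open>\<open>B = A \<triangle> C\<close> is the unique set with \<open>A \<triangle> B = C\<close>.\<close>

definition times_clifford :: "'a clifford \<Rightarrow> 'a clifford \<Rightarrow> 'a clifford" where
  "x * y = Clifford (\<lambda>C. \<Sum>A\<in>UNIV.
     blade_sign A (sym_diff A C) * blade_coeff x A * blade_coeff y (sym_diff A C))"

lemma blade_coeff_simps [simp]:
  "blade_coeff (0 :: 'a clifford) A = 0"
  "blade_coeff (1 :: 'a clifford) A = (if A = {} then 1 else 0)"
  "blade_coeff (x + y :: 'a clifford) A = blade_coeff x A + blade_coeff y A"
  "blade_coeff (- x :: 'a clifford) A = - blade_coeff x A"
  "blade_coeff (x - y :: 'a clifford) A = blade_coeff x A - blade_coeff y A"
  "blade_coeff (r *\<^sub>R x :: 'a clifford) A = r *\<^sub>R blade_coeff x A"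
  by (simp_all add: zero_clifford_def one_clifford_def plus_clifford_def uminus_clifford_def
      minus_clifford_def scaleR_clifford_def)

lemma blade_coeff_times:
  "blade_coeff (x * y :: 'a clifford) C = (\<Sum>A\<in>UNIV.
     blade_sign A (sym_diff A C) * blade_coeff x A * blade_coeff y (sym_diff A C))"
  by (simp add: times_clifford_def)

lemma clifford_mult_assoc: "(x * y) * z = x * (y * z :: 'a clifford)"
proof (rule clifford_eqI)
  fix D :: "'a set"
  have sd: "sym_diff A (sym_diff A B) = B" "sym_diff (sym_diff A B) (sym_diff A D) = sym_diff B D"
    for A B :: "'a set" by auto
  have "blade_coeff ((x * y) * z) D
      = (\<Sum>C\<in>UNIV. \<Sum>A\<in>UNIV. blade_sign C (sym_diff C D) * (blade_sign A (sym_diff A C)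
          * blade_coeff x A * blade_coeff y (sym_diff A C)) * blade_coeff z (sym_diff C D))"
    by (simp add: blade_coeff_times sum_distrib_left sum_distrib_right)
  also have "\<dots> = (\<Sum>A\<in>UNIV. \<Sum>C\<in>UNIV. blade_sign C (sym_diff C D) * (blade_sign A (sym_diff A C)
          * blade_coeff x A * blade_coeff y (sym_diff A C)) * blade_coeff z (sym_diff C D))"
    by (rule sum.swap)
  also have "\<dots> = (\<Sum>A\<in>UNIV. \<Sum>B\<in>UNIV. blade_sign (sym_diff A B) (sym_diff (sym_diff A B) D)
          * (blade_sign A B * blade_coeff x A * blade_coeff y B)
          * blade_coeff z (sym_diff (sym_diff A B) D))"
  proof (rule sum.cong [OF refl])
    fix A :: "'a set"
    show "(\<Sum>C\<in>UNIV. blade_sign C (sym_diff C D) * (blade_sign A (sym_diff A C)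
          * blade_coeff x A * blade_coeff y (sym_diff A C)) * blade_coeff z (sym_diff C D))
        = (\<Sum>B\<in>UNIV. blade_sign (sym_diff A B) (sym_diff (sym_diff A B) D)
          * (blade_sign A B * blade_coeff x A * blade_coeff y B)
          * blade_coeff z (sym_diff (sym_diff A B) D))"
      by (rule sum.reindex_bij_witness [of _ "sym_diff A" "sym_diff A"]) (simp_all only: sd UNIV_I)
  qed
  also have "\<dots> = (\<Sum>A\<in>UNIV. \<Sum>B\<in>UNIV. blade_sign A (sym_diff A D) * blade_coeff x A
          * (blade_sign B (sym_diff B (sym_diff A D)) * blade_coeff y B
             * blade_coeff z (sym_diff B (sym_diff A D))))"
  proof (intro sum.cong refl)
    fix A B :: "'a set"
    define E where "E = sym_diff B (sym_diff A D)"
    have E: "sym_diff (sym_diff A B) D = E" "sym_diff A D = sym_diff B E"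
      by (auto simp: E_def)
    show "blade_sign (sym_diff A B) (sym_diff (sym_diff A B) D)
          * (blade_sign A B * blade_coeff x A * blade_coeff y B)
          * blade_coeff z (sym_diff (sym_diff A B) D)
        = blade_sign A (sym_diff A D) * blade_coeff x A
          * (blade_sign B (sym_diff B (sym_diff A D)) * blade_coeff y B
             * blade_coeff z (sym_diff B (sym_diff A D)))"
      unfolding E_def [symmetric] E(1)
      unfolding E(2) blade_sign_sym_diff_left blade_sign_sym_diff_right
      by (simp add: mult_ac)
  qed
  also have "\<dots> = blade_coeff (x * (y * z)) D"
    by (simp add: blade_coeff_times sum_distrib_left)
  finally show "blade_coeff ((x * y) * z) D = blade_coeff (x * (y * z)) D" .
qed

instance
proof
  fix x y z :: "'a clifford" and r q :: real
  have sd: "sym_diff A A = {}" "(sym_diff A B = {}) = (A = B)" "sym_diff A {} = A"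
    for A B :: "'a set" by auto
  show "x * y * z = x * (y * z)"
    by (rule clifford_mult_assoc)
  show "1 * x = x"
    by (rule clifford_eqI) (simp add: blade_coeff_times if_distrib if_distribR cong: if_cong)
  have "blade_coeff (x * 1) C = (\<Sum>A\<in>UNIV. if A = C then blade_coeff x C else 0)" for C
    unfolding blade_coeff_times by (rule sum.cong) (auto simp: sd)
  then show "x * 1 = x"
    by (intro clifford_eqI) simp
  show "(0 :: 'a clifford) \<noteq> 1"
    by (auto dest: arg_cong [where f = "\<lambda>x. blade_coeff x {}"])
qed (rule clifford_eqI; simp add: blade_coeff_times algebra_simps sum.distrib
      sum_distrib_left scaleR_sum_right)+

end

definition scaleC :: "complex \<Rightarrow> 'n clifford \<Rightarrow> 'n clifford" where
  "scaleC c x = Clifford (\<lambda>A. c * blade_coeff x A)"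

lemma blade_coeff_scaleC [simp]: "blade_coeff (scaleC c x) A = c * blade_coeff x A"
  by (simp add: scaleC_def)

lemma scaleC_mult:
  fixes x y :: "'n::{finite,linorder} clifford"
  shows "scaleC c x * y = scaleC c (x * y)" "x * scaleC c y = scaleC c (x * y)"
  by (rule clifford_eqI; simp add: blade_coeff_times sum_distrib_left mult_ac)+

definition blade :: "'n set \<Rightarrow> 'n clifford" where
  "blade A = Clifford (\<lambda>B. if B = A then 1 else 0)"

abbreviation gen :: "'n \<Rightarrow> 'n clifford" where
  "gen i \<equiv> blade {i}"

lemma blade_mult:
  fixes A B :: "'n::{finite,linorder} set"
  shows "blade A * blade B = scaleC (blade_sign A B) (blade (sym_diff A B))"
proof (rule clifford_eqI)
  fix C :: "'n set"
  have eq: "sym_diff A C = B \<longleftrightarrow> C = sym_diff A B" and [simp]: "sym_diff A (sym_diff A B) = B"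
    by auto
  have "blade_coeff (blade A * blade B) C
      = (\<Sum>D\<in>UNIV. if D = A then blade_sign A (sym_diff A C) * (if C = sym_diff A B then 1 else 0)
                    else 0)"
    unfolding blade_coeff_times by (rule sum.cong) (auto simp: blade_def eq)
  then show "blade_coeff (blade A * blade B) C
      = blade_coeff (scaleC (blade_sign A B) (blade (sym_diff A B))) C"
    by (simp add: blade_def)
qed

text \<open>
  The defining relations, and the fact that the \<open>2 ^ CARD('n)\<close> blades, which are the ordered
  products of generators, form a basis: this identifies the type with the algebra generated by
  the \<open>e\<^sub>i\<close> subject to these relations.
\<close>

lemma gen_relations:
  fixes i j :: "'n::{finite,linorder}"
  shows "gen i * gen j + gen j * gen i = (if i = j then - 2 else 0)"
proof (cases "i = j")
  case True
  have "gen i * gen i = (- 1 :: 'n clifford)"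
    unfolding blade_mult by (rule clifford_eqI) (simp add: blade_def blade_sign_def)
  then show ?thesis
    using True by simp
next
  case False
  have *: "sym_diff {i} {j} = {i, j}" "sym_diff {j} {i} = {i, j}"
    using False by auto
  show ?thesis
    using False unfolding blade_mult *
    by (intro clifford_eqI) (auto simp: blade_def blade_sign_def)
qed

lemma blade_eq_prod_gen:
  fixes A :: "'n::{finite,linorder} set"
  shows "blade A = prod_list (map gen (sorted_list_of_set A))"
proof -
  have "blade (set xs) = prod_list (map gen xs)" if "sorted_wrt (<) xs" for xs :: "'n list"
    using that
  proof (induction xs)
    case Nil
    show ?case
      by (rule clifford_eqI) (simp add: blade_def)
  next
    case (Cons x xs)
    have x: "sym_diff {x} (set xs) = set (x # xs)" "blade_sign {x} (set xs) = 1"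
      using Cons.prems by (force simp: blade_sign_def intro!: prod.neutral)+
    have "gen x * blade (set xs) = blade (set (x # xs))"
      unfolding blade_mult x by (rule clifford_eqI) simp
    then show ?case
      using Cons by simp
  qed
  from this [of "sorted_list_of_set A"] show ?thesis
    by simp
qed

lemma blade_expansion:
  fixes x :: "'n::{finite,linorder} clifford"
  shows "x = (\<Sum>A\<in>UNIV. scaleC (c A) (blade A)) \<longleftrightarrow> c = blade_coeff x"
proof -
  have sum: "blade_coeff (sum f T) B = (\<Sum>A\<in>T. blade_coeff (f A) B)"
    for f :: "'n set \<Rightarrow> 'n clifford" and T B
    by (induction T rule: infinite_finite_induct) auto
  have "blade_coeff (\<Sum>A\<in>UNIV. scaleC (c A) (blade A)) B = c B" for B
    by (simp add: sum blade_def if_distrib cong: if_cong)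
  then show ?thesis
    by (metis clifford_eqI ext)
qed


section \<open>The spin group\<close>

definition vec_embed :: "real ^ 'n::{finite,linorder} \<Rightarrow> 'n clifford" where
  "vec_embed x = (\<Sum>j\<in>UNIV. (x $ j) *\<^sub>R gen j)"

definition Spin :: "'n::{finite,linorder} clifford set" where
  "Spin = {prod_list (map vec_embed us) | us :: (real ^ 'n::{finite,linorder}) list.
             even (length us) \<and> (\<forall>u\<in>set us. norm u = 1)}"

text \<open>The two-sided inverse; unspecified for elements that are not invertible.\<close>

definition cinv :: "'n::{finite,linorder} clifford \<Rightarrow> 'n clifford" where
  "cinv s = (THE t. s * t = 1 \<and> t * s = 1)"

lemma cinv_eqI:
  assumes "s * t = 1" "t * s = 1"
  shows "cinv s = t"
  unfolding cinv_def using assms by (intro the_equality) (auto, metis mult.assoc mult_1_left mult_1_right)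


section \<open>Simplicial variables\<close>

definition wedge :: "(real ^ 'n::{finite,linorder}) list \<Rightarrow> 'n clifford" where
  "wedge us = (1 / fact (length us)) *\<^sub>R
     (\<Sum>\<sigma> | \<sigma> permutes {..<length us}.
        of_int (sign \<sigma>) * prod_list (map (\<lambda>i. vec_embed (us ! \<sigma> i)) [0..<length us]))"

text \<open>\<open>wedge (map u (sorted_list_of_set {..k}))\<close> is \<open>u\<^sub>1 \<and> \<dots> \<and> u\<^sub>k\<close>.\<close>

definition simplicial_variable :: "('n \<Rightarrow> real ^ 'n::{finite,linorder}) \<Rightarrow> 'n clifford" where
  "simplicial_variable u = (\<Sum>k\<in>UNIV. wedge (map u (sorted_list_of_set {..k})))"

text \<open>
  A family of orthonormal vectors indexed by \<open>'n\<close> is automatically a basis of \<open>real ^ 'n\<close>, and it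
  is oriented like the standard basis iff the matrix of its coordinates has positive determinant.
\<close>

definition right_handed_orthonormal_basis :: "('n::finite \<Rightarrow> real ^ 'n) \<Rightarrow> bool" where
  "right_handed_orthonormal_basis u \<longleftrightarrow>
     (\<forall>i j. u i \<bullet> u j = (if i = j then 1 else 0)) \<and> det (\<chi> i. u i) > 0"

definition simplicial_variables :: "'n::{finite,linorder} clifford set" where
  "simplicial_variables = {simplicial_variable u | u. right_handed_orthonormal_basis u}"

text \<open>
  Functions with a prescribed domain are rendered as partial maps, so that the domain of
  \<open>H_rep s f\<close> is the set of all \<open>a\<close> for which \<open>f\<close> is defined at \<open>s\<^sup>-\<^sup>1 a s\<close>.
\<close>

definition simplicial_type :: "('n::{finite,linorder} clifford \<rightharpoonup> 'n clifford) \<Rightarrow> bool" where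
  "simplicial_type f \<longleftrightarrow> dom f = simplicial_variables"

definition H_rep :: "'n::{finite,linorder} clifford \<Rightarrow> ('n clifford \<rightharpoonup> 'n clifford)
    \<Rightarrow> ('n clifford \<rightharpoonup> 'n clifford)" where
  "H_rep s f = (\<lambda>a. map_option (\<lambda>y. s * y * cinv s) (f (cinv s * a * s)))"

end

theory Submission
  imports Defs
begin

text \<open>
  Conjugation by an element of the spin group rotates vectors, and simplicial variables are built
  from vectors by operations that commute with every such conjugation.

  For a unit vector \<open>w\<close> the Clifford relations give \<open>w v w = v - 2 \<langle>v, w\<rangle> w\<close>, the reflection of
  \<open>v\<close> in the hyperplane orthogonal to \<open>w\<close> (\<open>sandwich_unit_vector\<close>).  Let \<open>s = s\<^sub>1 \<dots> s\<^sub>k\<close> be a product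
  of unit vectors with \<open>k\<close> even.  Since \<open>s\<^sub>i\<^sup>2 = -1\<close>, the inverse of \<open>s\<close> is the reversed product
  \<open>s\<^sub>k \<dots> s\<^sub>1\<close>, which again lies in the spin group.  So \<open>s\<inverse> v s\<close> arises from \<open>v\<close> by \<open>k\<close>
  successive reflections, each of determinant \<open>-1\<close>; their composition \<open>T\<close> is orthogonal of
  determinant \<open>1\<close> (\<open>Spin_rotation\<close>).

  Conjugation by \<open>s\<close> is an algebra automorphism, hence maps \<open>u\<^sub>1 \<and> \<dots> \<and> u\<^sub>j\<close> to
  \<open>T u\<^sub>1 \<and> \<dots> \<and> T u\<^sub>j\<close> and \<open>a(u\<^sub>1, \<dots>, u\<^sub>m)\<close> to \<open>a(T u\<^sub>1, \<dots>, T u\<^sub>m)\<close>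
  (\<open>conj_simplicial_variable\<close>), and \<open>T\<close> preserves right-handed orthonormal bases.  Applying the
  same to \<open>s\<inverse>\<close> shows that \<open>s\<inverse> a s\<close> is a simplicial variable only if \<open>a\<close> is one.  Therefore the
  domain of \<open>H(s) f\<close>, the set of all \<open>a\<close> for which \<open>f (s\<inverse> a s)\<close> is defined, is exactly the set
  of simplicial variables.
\<close>

section \<open>Vectors in the Clifford algebra\<close>

lemma vec_embed_scaleR: "vec_embed (c *\<^sub>R x) = c *\<^sub>R vec_embed x"
  by (simp add: vec_embed_def scaleR_sum_right)

lemma vec_embed_diff: "vec_embed (x - y) = vec_embed x - vec_embed y"
  by (simp add: vec_embed_def scaleR_diff_left sum_subtractf)

text \<open>The bilinear extension of the relations \<open>e\<^sub>i e\<^sub>j + e\<^sub>j e\<^sub>i = - 2 \<delta>\<^bsub>ij\<^esub>\<close>.\<close>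

lemma vec_embed_anticommute:
  fixes x y :: "real ^ 'n::{finite,linorder}"
  shows "vec_embed x * vec_embed y + vec_embed y * vec_embed x = - (2 * (x \<bullet> y)) *\<^sub>R 1"
proof -
  have "vec_embed x * vec_embed y + vec_embed y * vec_embed x
      = (\<Sum>i\<in>UNIV. \<Sum>j\<in>UNIV. (x $ i * y $ j) *\<^sub>R (gen i * gen j))
        + (\<Sum>j\<in>UNIV. \<Sum>i\<in>UNIV. (x $ i * y $ j) *\<^sub>R (gen j * gen i))"
    by (simp add: vec_embed_def sum_product mult.commute)
  also have "(\<Sum>j\<in>UNIV. \<Sum>i\<in>UNIV. (x $ i * y $ j) *\<^sub>R (gen j * gen i))
      = (\<Sum>i\<in>UNIV. \<Sum>j\<in>UNIV. (x $ i * y $ j) *\<^sub>R (gen j * gen i :: 'n clifford))"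
    by (rule sum.swap)
  also have "(\<Sum>i\<in>UNIV. \<Sum>j\<in>UNIV. (x $ i * y $ j) *\<^sub>R (gen i * gen j)) + \<dots>
      = (\<Sum>i\<in>UNIV. \<Sum>j\<in>UNIV. (x $ i * y $ j) *\<^sub>R (gen i * gen j + gen j * gen i))"
    by (simp add: sum.distrib scaleR_add_right)
  also have "\<dots> = (\<Sum>i\<in>UNIV. \<Sum>j\<in>UNIV. if j = i then (x $ i * y $ i) *\<^sub>R (- 2) else 0)"
    by (intro sum.cong refl) (auto simp: gen_relations)
  also have "\<dots> = (\<Sum>i\<in>UNIV. (x $ i * y $ i) *\<^sub>R (- 2))"
    by simp
  also have "\<dots> = (x \<bullet> y) *\<^sub>R (- 2)"
    by (simp only: inner_vec_def inner_real_def scaleR_sum_left)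
  also have "\<dots> = - (2 * (x \<bullet> y)) *\<^sub>R 1"
    using scaleR_2 [of "1 :: 'n clifford"]
    by (simp add: mult.commute flip: scaleR_scaleR)
  finally show ?thesis .
qed

lemma vec_embed_square:
  fixes w :: "real ^ 'n::{finite,linorder}"
  assumes "norm w = 1"
  shows "vec_embed w * vec_embed w = - 1"
proof -
  have "2 *\<^sub>R (vec_embed w * vec_embed w) = 2 *\<^sub>R (- 1 :: 'n clifford)"
    unfolding scaleR_2 [of "vec_embed w * vec_embed w"] vec_embed_anticommute
    using assms by (simp only: norm_eq_1 mult_1_right scaleR_minus_left scaleR_minus_right)
  then show ?thesis
    by (rule scaleR_left_imp_eq [rotated]) simp
qed

section \<open>Reflections\<close>

text \<open>
  There is no division by \<open>w \<bullet> w\<close>, so this is the reflection in the hyperplane orthogonal to \<open>w\<close>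
  only when \<open>w\<close> is a unit vector.
\<close>

definition reflection :: "'a::real_inner \<Rightarrow> 'a \<Rightarrow> 'a" where
  "reflection w v = v - (2 * (v \<bullet> w)) *\<^sub>R w"

lemma orthogonal_transformation_reflection:
  assumes "norm w = 1"
  shows "orthogonal_transformation (reflection w)"
proof -
  have "linear (reflection w)"
    by (rule linearI) (simp_all add: reflection_def algebra_simps)
  then show ?thesis
    using assms
    by (auto simp: orthogonal_transformation_def reflection_def norm_eq_1 inner_diff_left
        inner_diff_right inner_commute)
qed

lemma orthogonal_transformation_reflection_commute:
  assumes "orthogonal_transformation f"
  shows "reflection (f w) \<circ> f = f \<circ> reflection w"
  using assms orthogonal_transformation_linear [OF assms]
  by (auto simp: reflection_def orthogonal_transformation_def linear_diff linear_cmul)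

text \<open>The matrix is diagonal: the \<open>k\<close>-th diagonal entry is \<open>-1\<close>, the others are \<open>1\<close>.\<close>

lemma det_reflection_axis: "det (matrix (reflection (axis k 1 :: real ^ 'n))) = - 1"
proof -
  let ?A = "matrix (reflection (axis k 1 :: real ^ 'n))"
  have A: "?A $ i $ j = (if i = j then if i = k then - 1 else 1 else 0)" for i j
    by (auto simp: matrix_def reflection_def inner_axis_axis)
       (auto simp: axis_def)
  have "det ?A = (\<Prod>i\<in>UNIV. if i = k then - 1 else 1)"
    by (subst det_diagonal) (simp_all add: A)
  then show ?thesis
    by simp
qed

text \<open>
  An orthogonal map carrying an axis to \<open>w\<close> conjugates the reflection along that axis into the
  reflection along \<open>w\<close>, so both have the same determinant.
\<close>

lemma det_reflection:
  fixes w :: "real ^ 'n"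
  assumes "norm w = 1"
  shows "det (matrix (reflection w)) = - 1"
proof -
  fix k :: 'n
  obtain f :: "real ^ 'n \<Rightarrow> real ^ 'n" where f: "orthogonal_transformation f" "f (axis k 1) = w"
    by (rule orthogonal_transformation_exists_1 [of "axis k 1" w]) (simp_all add: assms)
  have lin: "linear f" "linear (reflection w)" "linear (reflection (axis k 1 :: real ^ 'n))"
    using f assms by (auto intro!: orthogonal_transformation_linear
        orthogonal_transformation_reflection)
  have "matrix (reflection w) ** matrix f = matrix f ** matrix (reflection (axis k 1))"
    using orthogonal_transformation_reflection_commute [OF f(1), of "axis k 1"] lin
    by (simp add: f(2) flip: matrix_compose)
  then have "det (matrix (reflection w)) * det (matrix f) = - det (matrix f)"
    by (metis det_mul det_reflection_axis mult_minus1_right)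
  moreover have "det (matrix f) \<noteq> 0"
    using det_orthogonal_matrix [of "matrix f"] f(1) orthogonal_transformation_matrix by fastforce
  ultimately show ?thesis
    by (metis mult_cancel_right mult_minus1)
qed

lemma orthogonal_transformation_fold_reflection:
  fixes us :: "'a::real_inner list"
  assumes "\<forall>w\<in>set us. norm w = 1"
  shows "orthogonal_transformation (fold reflection us)"
  using assms
proof (induction us)
  case (Cons w ws)
  have "orthogonal_transformation (fold reflection ws \<circ> reflection w)"
    by (rule orthogonal_transformation_compose)
      (use Cons in \<open>simp_all add: orthogonal_transformation_reflection\<close>)
  then show ?case
    by (simp only: fold_Cons)
qed (simp add: id_def orthogonal_transformation_id)

lemma det_fold_reflection:
  assumes "\<forall>w\<in>set us. norm (w :: real ^ 'n) = 1"
  shows "det (matrix (fold reflection us)) = (- 1) ^ length us"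
  using assms
proof (induction us)
  case (Cons w ws)
  have "matrix (fold reflection ws \<circ> reflection w)
      = matrix (fold reflection ws) ** matrix (reflection w)"
    using Cons.prems
    by (intro matrix_compose orthogonal_transformation_linear
        orthogonal_transformation_fold_reflection orthogonal_transformation_reflection) auto
  then have "det (matrix (fold reflection (w # ws)))
      = det (matrix (fold reflection ws)) * det (matrix (reflection w))"
    by (simp only: fold_Cons det_mul)
  also have "\<dots> = (- 1) ^ length (w # ws)"
    using Cons by (simp add: det_reflection)
  finally show ?case .
qed (simp add: matrix_id_mat_1)

section \<open>Sandwich products\<close>

text \<open>Moving \<open>v\<close> past the right-hand \<open>w\<close> gives \<open>w (- 2 \<langle>v, w\<rangle> - w v)\<close>, and \<open>w\<^sup>2 = -1\<close>.\<close>

lemma sandwich_unit_vector: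
  fixes v w :: "real ^ 'n::{finite,linorder}"
  assumes "norm w = 1"
  shows "vec_embed w * vec_embed v * vec_embed w = vec_embed (reflection w v)"
proof -
  have vw: "vec_embed v * vec_embed w = - (2 * (v \<bullet> w)) *\<^sub>R 1 - vec_embed w * vec_embed v"
    unfolding eq_diff_eq by (rule vec_embed_anticommute)
  have "vec_embed w * vec_embed v * vec_embed w
      = - (2 * (v \<bullet> w)) *\<^sub>R vec_embed w - (vec_embed w * vec_embed w) * vec_embed v"
    unfolding mult.assoc vw by (simp add: algebra_simps)
  also have "\<dots> = vec_embed (reflection w v)"
    using assms
    by (simp add: vec_embed_square reflection_def vec_embed_diff vec_embed_scaleR
        norm_eq_1)
  finally show ?thesis .
qed

text \<open>
  The product telescopes from the inside, each pair \<open>w w\<close> leaving the central factor \<open>-1\<close>.  For an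
  even number of factors the reversed product is therefore an inverse.
\<close>

lemma unit_vectors_mult_rev:
  assumes "\<forall>w\<in>set us. norm (w :: real ^ 'n::{finite,linorder}) = 1"
  shows "prod_list (map vec_embed us) * prod_list (map vec_embed (rev us)) = (- 1) ^ length us"
  using assms
proof (induction us)
  case (Cons w ws)
  have "prod_list (map vec_embed (w # ws)) * prod_list (map vec_embed (rev (w # ws)))
      = vec_embed w * (prod_list (map vec_embed ws) * prod_list (map vec_embed (rev ws)))
        * vec_embed w"
    by (simp add: mult.assoc)
  also have "\<dots> = (- 1) ^ length ws * (vec_embed w * vec_embed w)"
    using Cons by (cases "even (length ws)") auto
  also have "\<dots> = (- 1) ^ length (w # ws)"
    using Cons.prems by (simp add: vec_embed_square)
  finally show ?case .
qed simp

text \<open>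
  The first factor of the product is the innermost one of the sandwich, so it reflects first; this
  is the order in which \<open>fold\<close> composes.
\<close>

lemma sandwich_unit_vectors:
  fixes v :: "real ^ 'n::{finite,linorder}"
  assumes "\<forall>w\<in>set us. norm w = 1"
  shows "prod_list (map vec_embed (rev us)) * vec_embed v * prod_list (map vec_embed us)
       = vec_embed (fold reflection us v)"
  using assms
proof (induction us arbitrary: v)
  case (Cons w ws)
  have "prod_list (map vec_embed (rev (w # ws))) * vec_embed v * prod_list (map vec_embed (w # ws))
      = prod_list (map vec_embed (rev ws)) * (vec_embed w * vec_embed v * vec_embed w)
        * prod_list (map vec_embed ws)"
    by (simp add: mult.assoc)
  also have "vec_embed w * vec_embed v * vec_embed w = vec_embed (reflection w v)"
    using Cons.prems by (intro sandwich_unit_vector) simp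
  also have "prod_list (map vec_embed (rev ws)) * \<dots> * prod_list (map vec_embed ws)
      = vec_embed (fold reflection ws (reflection w v))"
    using Cons.prems by (intro Cons.IH) simp
  finally show ?case
    by simp
qed simp

section \<open>Transport of simplicial variables\<close>

text \<open>
  The coordinate matrix has the basis vectors as its rows, so applying \<open>T\<close> to each of them
  multiplies it on the right by the transpose of the matrix of \<open>T\<close>.
\<close>

lemma right_handed_orthonormal_basis_rotate:
  fixes T :: "real ^ 'n \<Rightarrow> real ^ 'n"
  assumes T: "orthogonal_transformation T" and det: "det (matrix T) = 1"
    and u: "right_handed_orthonormal_basis u"
  shows "right_handed_orthonormal_basis (T \<circ> u)"
proof -
  have T_eq: "T (u i) = matrix T *v u i" for i
    using orthogonal_transformation_linear [OF T] by (simp add: matrix_works)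
  have "(\<chi> i. (T \<circ> u) i) = (\<chi> i. u i) ** transpose (matrix T)"
    unfolding o_apply T_eq
    by (simp add: vec_eq_iff matrix_matrix_mult_def matrix_vector_mult_def transpose_def mult.commute)
  then have "det (\<chi> i. (T \<circ> u) i) = det (\<chi> i. u i)"
    by (simp add: det_mul det)
  then show ?thesis
    using T u by (simp add: right_handed_orthonormal_basis_def orthogonal_transformation_def)
qed

lemma conj_prod_list:
  fixes s t :: "'a::monoid_mult"
  assumes "s * t = 1" "t * s = 1"
  shows "t * prod_list xs * s = prod_list (map (\<lambda>x. t * x * s) xs)"
proof (induction xs)
  case (Cons x xs)
  have "t * prod_list (x # xs) * s = t * x * (s * t) * prod_list xs * s"
    by (simp add: assms mult.assoc)
  also have "\<dots> = (t * x * s) * (t * prod_list xs * s)"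
    by (simp add: mult.assoc)
  finally show ?case
    using Cons by simp
qed (simp add: assms)

text \<open>
  The outer product is a linear combination, with real (hence central) coefficients, of products of
  vectors, and conjugation acts on each factor separately.
\<close>

lemma conj_wedge:
  fixes s t :: "'n::{finite,linorder} clifford"
  assumes "s * t = 1" "t * s = 1"
    and T: "\<And>v. t * vec_embed v * s = vec_embed (T v)"
  shows "t * wedge us * s = wedge (map T us)"
proof -
  have "t * (of_int (sign \<sigma>) * prod_list (map (\<lambda>i. vec_embed (us ! \<sigma> i)) [0..<length us])) * s
      = of_int (sign \<sigma>)
        * prod_list (map (\<lambda>i. vec_embed (map T us ! \<sigma> i)) [0..<length us])"
    if \<sigma>: "\<sigma> permutes {..<length us}" for \<sigma>
  proof -
    have "\<sigma> i < length us" if "i < length us" for i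
      using permutes_in_image [OF \<sigma>, of i] that by simp
    then have "map (\<lambda>x. t * x * s) (map (\<lambda>i. vec_embed (us ! \<sigma> i)) [0..<length us])
        = map (\<lambda>i. vec_embed (map T us ! \<sigma> i)) [0..<length us]"
      by (simp add: T)
    then have "t * prod_list (map (\<lambda>i. vec_embed (us ! \<sigma> i)) [0..<length us]) * s
        = prod_list (map (\<lambda>i. vec_embed (map T us ! \<sigma> i)) [0..<length us])"
      by (simp only: conj_prod_list [OF assms(1,2)])
    moreover have "t * (of_int (sign \<sigma>) * p) * s = of_int (sign \<sigma>) * (t * p * s)" for p
      by (simp add: sign_def)
    ultimately show ?thesis
      by simp
  qed
  then show ?thesis
    by (simp add: wedge_def sum_distrib_left sum_distrib_right)
qed

lemma conj_simplicial_variable: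
  fixes s t :: "'n::{finite,linorder} clifford"
  assumes "s * t = 1" "t * s = 1"
    and T: "\<And>v. t * vec_embed v * s = vec_embed (T v)"
  shows "t * simplicial_variable u * s = simplicial_variable (T \<circ> u)"
  by (simp add: simplicial_variable_def sum_distrib_left sum_distrib_right
      conj_wedge [OF assms])

section \<open>The action of the spin group\<close>

text \<open>
  All claims come from one representation of \<open>s\<close> as a product of an even number of unit vectors:
  its reversal represents the inverse, and the corresponding reflections compose to a rotation.
\<close>

lemma Spin_inverse:
  assumes "s \<in> Spin"
  shows "cinv s \<in> Spin" "s * cinv s = 1" "cinv s * s = 1" "cinv (cinv s) = s"
    and Spin_rotation: "\<exists>T. orthogonal_transformation T \<and> det (matrix T) = 1 \<and>
      (\<forall>v. cinv s * vec_embed v * s = vec_embed (T v))"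
proof -
  obtain us where s: "s = prod_list (map vec_embed us)" and even: "even (length us)"
    and unit: "\<forall>w\<in>set us. norm w = 1"
    using assms by (auto simp: Spin_def)
  let ?t = "prod_list (map vec_embed (rev us))"
  have inv: "s * ?t = 1" "?t * s = 1"
    using unit_vectors_mult_rev [of us] unit_vectors_mult_rev [of "rev us"] unit even by (simp_all add: s)
  then have cinv: "cinv s = ?t" "cinv ?t = s"
    by (auto intro: cinv_eqI)
  show "cinv s \<in> Spin"
    unfolding cinv Spin_def using unit even by (auto intro!: exI [of _ "rev us"])
  show "s * cinv s = 1" "cinv s * s = 1" "cinv (cinv s) = s"
    by (simp_all add: inv cinv)
  show "\<exists>T. orthogonal_transformation T \<and> det (matrix T) = 1 \<and>
      (\<forall>v. cinv s * vec_embed v * s = vec_embed (T v))"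
    using sandwich_unit_vectors [OF unit] det_fold_reflection [OF unit] even
      orthogonal_transformation_fold_reflection [OF unit]
    unfolding cinv unfolding s by auto
qed

lemma Spin_conj_simplicial_variables:
  fixes s :: "'n::{finite,linorder} clifford"
  assumes s: "s \<in> Spin" and a: "a \<in> simplicial_variables"
  shows "cinv s * a * s \<in> simplicial_variables"
proof -
  obtain T where T: "orthogonal_transformation T" "det (matrix T) = 1"
      "\<And>v. cinv s * vec_embed v * s = vec_embed (T v)"
    using Spin_rotation [OF s] by blast
  obtain u where u: "a = simplicial_variable u" "right_handed_orthonormal_basis u"
    using a by (auto simp: simplicial_variables_def)
  have "cinv s * a * s = simplicial_variable (T \<circ> u)"
    unfolding u by (rule conj_simplicial_variable) (use Spin_inverse [OF s] T(3) in auto)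
  then show ?thesis
    using right_handed_orthonormal_basis_rotate [OF T(1,2) u(2)]
    by (auto simp: simplicial_variables_def)
qed

text \<open>
  The converse direction, obtained from the action of \<open>s\<inverse>\<close>, is what prevents the domain of
  \<open>H_rep s f\<close> from being larger than the set of simplicial variables.
\<close>

lemma Spin_conj_simplicial_variables_iff:
  fixes s :: "'n::{finite,linorder} clifford"
  assumes s: "s \<in> Spin"
  shows "cinv s * a * s \<in> simplicial_variables \<longleftrightarrow> a \<in> simplicial_variables"
proof
  assume "cinv s * a * s \<in> simplicial_variables"
  then have "s * (cinv s * a * s) * cinv s \<in> simplicial_variables"
    using Spin_conj_simplicial_variables [of "cinv s"] Spin_inverse [OF s] by simp
  moreover have "s * (cinv s * a * s) * cinv s = (s * cinv s) * a * (s * cinv s)"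
    by (simp only: mult.assoc)
  ultimately show "a \<in> simplicial_variables"
    by (simp add: Spin_inverse [OF s])
qed (rule Spin_conj_simplicial_variables [OF s])

theorem corollary3p5:
  fixes s :: "'n::{finite,linorder} clifford"
  assumes "s \<in> Spin"
  shows "(\<forall>a\<in>simplicial_variables. cinv s * a * s \<in> simplicial_variables) \<and>
         (\<forall>f. simplicial_type f \<longrightarrow>
            simplicial_type (H_rep s f) \<and>
            (\<forall>a\<in>simplicial_variables.
               H_rep s f a = Some (s * the (f (cinv s * a * s)) * cinv s)))"
proof (intro conjI allI impI ballI)
  fix a :: "'n clifford" assume "a \<in> simplicial_variables"
  then show "cinv s * a * s \<in> simplicial_variables"
    by (rule Spin_conj_simplicial_variables [OF assms])
next
  fix f :: "'n clifford \<rightharpoonup> 'n clifford" assume f: "simplicial_type f"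
  have "dom (H_rep s f) = {a. cinv s * a * s \<in> dom f}"
    by (auto simp: H_rep_def)
  then show "simplicial_type (H_rep s f)"
    using f by (simp add: simplicial_type_def Spin_conj_simplicial_variables_iff [OF assms])
next
  fix f :: "'n clifford \<rightharpoonup> 'n clifford" and a :: "'n clifford"
  assume "simplicial_type f" "a \<in> simplicial_variables"
  then have "cinv s * a * s \<in> dom f"
    using Spin_conj_simplicial_variables [OF assms] by (simp add: simplicial_type_def)
  then show "H_rep s f a = Some (s * the (f (cinv s * a * s)) * cinv s)"
    by (auto simp: H_rep_def)
qed

end
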